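(* Let $G$ be a finite Abelian group of order $v=p_1^{2k_1}p_2^{2k_2}\cdots p_n^{2k_n}$, where $n\ge 2$, $p_1,\dots,p_n$ are distinct odd primes and $k_1,\dots,k_n$ are positive integers. If there is a regular Paley type partial difference set in $G$, then for every $1\le i\le n$ with $k_i$ odd we have $p_i\equiv 3 \pmod 4$.
   Context: For a finite Abelian group $G$ of order $v$ with identity $e$, a subset $D\subseteq G$ of size $k$ is a $(v,k,\lambda,\mu)$-partial difference set (PDS) if the expressions $gh^{-1}$ with $g,h\in D$, $g\neq h$, represent each non-identity element of $D$ exactly $\lambda$ times and each non-identity element of $G\setminus D$ exactly $\mu$ times. It is regular if $D^{(-1)}=\{g^{-1}:g\in D\}=D$ and $e\notin D$. A Paley type PDS is a PDS with parameters $(v,(v-1)/2,(v-5)/4,(v-1)/4)$. *)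

theory Defs
  imports "HOL-Algebra.Coset" "HOL-Number_Theory.Cong" "HOL-Computational_Algebra.Primes"
begin

definition partial_difference_set ::
    "('a, 'b) monoid_scheme \<Rightarrow> nat \<Rightarrow> nat \<Rightarrow> nat \<Rightarrow> nat \<Rightarrow> 'a set \<Rightarrow> bool" where
  "partial_difference_set G v k l m D \<longleftrightarrow>
     comm_group G \<and> finite (carrier G) \<and> order G = v \<and>
     D \<subseteq> carrier G \<and> card D = k \<and>
     (\<forall>x \<in> D - {\<one>\<^bsub>G\<^esub>}.
        card {(g, h). g \<in> D \<and> h \<in> D \<and> g \<noteq> h \<and> g \<otimes>\<^bsub>G\<^esub> inv\<^bsub>G\<^esub> h = x} = l) \<and>
     (\<forall>x \<in> carrier G - D - {\<one>\<^bsub>G\<^esub>}.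
        card {(g, h). g \<in> D \<and> h \<in> D \<and> g \<noteq> h \<and> g \<otimes>\<^bsub>G\<^esub> inv\<^bsub>G\<^esub> h = x} = m)"

definition regular_subset :: "('a, 'b) monoid_scheme \<Rightarrow> 'a set \<Rightarrow> bool" where
  "regular_subset G D \<longleftrightarrow> (\<lambda>g. inv\<^bsub>G\<^esub> g) ` D = D \<and> \<one>\<^bsub>G\<^esub> \<notin> D"

text \<open>The parameters \<open>(v, (v - 1) / 2, (v - 5) / 4, (v - 1) / 4)\<close> are given by equations free of
  subtraction and division, to avoid truncation on natural numbers.\<close>

definition paley_type_pds :: "('a, 'b) monoid_scheme \<Rightarrow> 'a set \<Rightarrow> bool" where
  "paley_type_pds G D \<longleftrightarrow>
     (\<exists>v k l m. partial_difference_set G v k l m D \<and>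
        2 * k + 1 = v \<and> 4 * l + 5 = v \<and> 4 * m + 1 = v)"

end

theory Submission
  imports Defs "HOL-Algebra.Sylow" "HOL-Algebra.Multiplicative_Group" "HOL-Number_Theory.Residues"
begin

text \<open>Let \<open>f\<close> be the function that is \<open>1\<close> on \<open>D\<close>, \<open>0\<close> at the identity and \<open>-1\<close> elsewhere. The Paley
  parameters say that \<open>f * f = v e - G\<close> in the integral group ring, and no characters are needed:
  everything follows from the Frobenius congruence \<open>f\<^sup>q \<equiv> \<Sum> f(g) g\<^sup>q\<close> modulo a prime \<open>q\<close>.

  As \<open>v\<close> is a square, \<open>f\<^sup>q = v\<^bsup>(q - 1)/2\<^esup> f \<equiv> f\<close> for every odd prime \<open>q\<close> not dividing \<open>v\<close>, so \<open>f\<close> is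
  invariant under \<open>x \<mapsto> x\<^sup>t\<close> for all odd \<open>t\<close> coprime to \<open>v\<close>.

  Let \<open>P\<close> be the Sylow subgroup of order \<open>p\<^bsup>2k\<^esup>\<close> and \<open>F\<close> the push-forward of \<open>f\<close> to \<open>G/P\<close>. Then \<open>F * F\<close> is
  divisible by \<open>p\<^bsup>2k\<^esup>\<close>, hence \<open>F\<close> is divisible by \<open>p\<^sup>k\<close>. Since \<open>F\<close> is odd away from the identity, the value
  of \<open>\<Sum> F\<^sup>2\<close> forces \<open>F = \<plusminus>p\<^sup>k\<close> there.

  Finally take \<open>y \<notin> P\<close> of order prime to \<open>p\<close>. The set of \<open>x \<in> P - {e}\<close> with \<open>f(xy) = 1\<close> is closed under
  powers prime to \<open>p\<close>, so \<open>p - 1\<close> divides its size and \<open>2(p - 1)\<close> divides \<open>F(Py) - f(y) = \<plusminus>p\<^sup>k \<plusminus> 1\<close>.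
  If \<open>p \<equiv> 1\<close> modulo \<open>4\<close>, this is \<open>\<plusminus>(p\<^sup>k - 1)\<close>, and \<open>(p\<^sup>k - 1)/(p - 1)\<close> would be even, which is false for
  odd \<open>k\<close>.\<close>

section \<open>Convolution on a finite abelian group\<close>

locale finite_comm_group = comm_group +
  assumes finite_carrier [simp]: "finite (carrier G)"
begin

text \<open>Multiplication of the integral group ring, an element being given by its coefficients.
  Values outside \<open>carrier G\<close> are irrelevant, so equalities are claimed only on the
  carrier.\<close>

definition conv :: "('a \<Rightarrow> int) \<Rightarrow> ('a \<Rightarrow> int) \<Rightarrow> 'a \<Rightarrow> int" where
  "conv f g z = (\<Sum>x\<in>carrier G. f x * g (inv x \<otimes> z))"

primrec conv_pow :: "('a \<Rightarrow> int) \<Rightarrow> nat \<Rightarrow> 'a \<Rightarrow> int" where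
  "conv_pow f 0 = (\<lambda>z. if z = \<one> then 1 else 0)"
| "conv_pow f (Suc n) = conv f (conv_pow f n)"

lemma sum_translate:
  assumes "a \<in> carrier G"
  shows "(\<Sum>x\<in>carrier G. f (a \<otimes> x)) = (\<Sum>x\<in>carrier G. f x)"
  by (rule sum.reindex_bij_witness[where i = "\<lambda>x. inv a \<otimes> x" and j = "\<lambda>x. a \<otimes> x"])
     (use assms in \<open>auto simp: m_assoc[symmetric]\<close>)

lemma conv_cong:
  assumes "\<And>x. x \<in> carrier G \<Longrightarrow> f x = f' x" "\<And>x. x \<in> carrier G \<Longrightarrow> g x = g' x" "z \<in> carrier G"
  shows "conv f g z = conv f' g' z"
  unfolding conv_def by (rule sum.cong) (use assms in auto)

lemma conv_pow_1:
  assumes "z \<in> carrier G"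
  shows "conv_pow f 1 z = f z"
proof -
  have "inv x \<otimes> z = \<one> \<longleftrightarrow> x = z" if "x \<in> carrier G" for x
    using that assms by (metis inv_closed inv_equality inv_inv l_inv)
  then have "conv_pow f 1 z = (\<Sum>x\<in>carrier G. if x = z then f x else 0)"
    unfolding One_nat_def conv_pow.simps conv_def by (intro sum.cong) auto
  then show ?thesis using assms by simp
qed

lemma conv_assoc:
  assumes "z \<in> carrier G"
  shows "conv f (conv g h) z = conv (conv f g) h z"
proof -
  have "conv (conv f g) h z = (\<Sum>y\<in>carrier G. \<Sum>x\<in>carrier G. f x * g (inv x \<otimes> y) * h (inv y \<otimes> z))"
    unfolding conv_def by (simp add: sum_distrib_right)
  also have "\<dots> = (\<Sum>x\<in>carrier G. \<Sum>y\<in>carrier G. f x * g (inv x \<otimes> y) * h (inv y \<otimes> z))"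
    by (rule sum.swap)
  also have "\<dots> = (\<Sum>x\<in>carrier G. f x * conv g h (inv x \<otimes> z))"
  proof (rule sum.cong)
    fix x assume x: "x \<in> carrier G"
    have "(\<Sum>y\<in>carrier G. f x * g (inv x \<otimes> y) * h (inv y \<otimes> z))
        = (\<Sum>y\<in>carrier G. f x * g (inv x \<otimes> (x \<otimes> y)) * h (inv (x \<otimes> y) \<otimes> z))"
      by (rule sum_translate[symmetric, OF x])
    also have "\<dots> = (\<Sum>y\<in>carrier G. f x * (g y * h (inv y \<otimes> (inv x \<otimes> z))))"
    proof (rule sum.cong)
      fix y assume y: "y \<in> carrier G"
      have "inv x \<otimes> (x \<otimes> y) = y" using x y by (simp add: m_assoc[symmetric])
      moreover have "inv (x \<otimes> y) \<otimes> z = inv y \<otimes> (inv x \<otimes> z)"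
        using x y assms by (simp add: inv_mult_group m_assoc)
      ultimately show "f x * g (inv x \<otimes> (x \<otimes> y)) * h (inv (x \<otimes> y) \<otimes> z)
          = f x * (g y * h (inv y \<otimes> (inv x \<otimes> z)))" by simp
    qed simp
    finally show "(\<Sum>y\<in>carrier G. f x * g (inv x \<otimes> y) * h (inv y \<otimes> z)) = f x * conv g h (inv x \<otimes> z)"
      unfolding conv_def by (simp add: sum_distrib_left)
  qed simp
  finally show ?thesis by (simp add: conv_def[of f])
qed

text \<open>The augmentation of the group ring is multiplicative: swap the sums and translate the
  inner one.\<close>

lemma sum_conv:
  "(\<Sum>z\<in>carrier G. conv f g z) = (\<Sum>x\<in>carrier G. f x) * (\<Sum>x\<in>carrier G. g x)"
proof -
  have "(\<Sum>z\<in>carrier G. conv f g z) = (\<Sum>x\<in>carrier G. \<Sum>z\<in>carrier G. f x * g (inv x \<otimes> z))"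
    unfolding conv_def by (rule sum.swap)
  also have "\<dots> = (\<Sum>x\<in>carrier G. f x * (\<Sum>z\<in>carrier G. g z))"
    by (rule sum.cong) (simp_all add: sum_distrib_left[symmetric] sum_translate)
  finally show ?thesis by (simp add: sum_distrib_right)
qed

end

section \<open>Binomial expansion and the Frobenius congruence in the group ring\<close>

text \<open>Pascal's rule, with \<open>b i j\<close> in the role of a product of an
  \<open>i\<close>-th and a \<open>j\<close>-th power; this is the induction step of the binomial
  theorem.\<close>

lemma binomial_recursion_sum:
  fixes b :: "nat \<Rightarrow> nat \<Rightarrow> int"
  shows "(\<Sum>k\<le>n. int (n choose k) * (b (Suc (n - k)) k + b (n - k) (Suc k)))
       = (\<Sum>k\<le>Suc n. int (Suc n choose k) * b (Suc n - k) k)"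
proof -
  have "(\<Sum>k\<le>Suc n. int (Suc n choose k) * b (Suc n - k) k)
      = b (Suc n) 0 + (\<Sum>k\<le>n. int (n choose k) * b (n - k) (Suc k))
        + (\<Sum>k\<le>n. int (n choose Suc k) * b (n - k) (Suc k))"
    by (subst sum.atMost_Suc_shift) (simp add: algebra_simps sum.distrib)
  moreover have "b (Suc n) 0 + (\<Sum>k\<le>n. int (n choose Suc k) * b (n - k) (Suc k))
      = (\<Sum>k\<le>Suc n. int (n choose k) * b (Suc n - k) k)"
    by (subst sum.atMost_Suc_shift) simp
  moreover have "\<dots> = (\<Sum>k\<le>n. int (n choose k) * b (Suc (n - k)) k)"
    by (simp add: Suc_diff_le)
  ultimately show ?thesis by (simp add: algebra_simps sum.distrib)
qed

text \<open>Fermat's little theorem for all integers: multiples of \<open>q\<close> are immediate,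
  and the rest reduce to a natural residue \<open>r\<close>.\<close>

lemma prime_dvd_power_diff_self:
  fixes a :: int
  assumes "prime q"
  shows "int q dvd a ^ q - a"
proof (cases "int q dvd a")
  case True
  then show ?thesis using assms by (simp add: dvd_power_le dvd_diff prime_gt_0_nat dvd_power dvd_trans)
next
  case False
  define r where "r = nat (a mod int q)"
  have q0: "q > 0" using assms prime_gt_0_nat by blast
  have r: "[a = int r] (mod int q)" using q0 by (simp add: r_def cong_def)
  then have "\<not> q dvd r" using False by (metis cong_dvd_iff int_dvd_int_iff)
  then have "[r ^ (q - 1) = 1] (mod q)" using fermat_theorem assms by blast
  then have "[int r ^ (q - 1) = 1] (mod int q)" by (metis cong_int_iff of_nat_1 of_nat_power)
  then have "[a ^ (q - 1) = 1] (mod int q)" using r by (meson cong_pow cong_trans)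
  then have "[a * a ^ (q - 1) = a * 1] (mod int q)" by (rule cong_scalar_left)
  then have "[a ^ q = a] (mod int q)" using q0 by (metis mult.right_neutral power_eq_if not_gr_zero)
  then show ?thesis by (simp add: cong_iff_dvd_diff)
qed

context finite_comm_group
begin

text \<open>The binomial theorem for \<open>f\<close> and the monomial \<open>a g\<close>, which
  commute. Multiplying by the \<open>k\<close>-th power of the monomial scales by
  \<open>a ^ k\<close> and translates by \<open>g [^] k\<close>.\<close>

lemma conv_pow_add_single:
  assumes g: "g \<in> carrier G" and z: "z \<in> carrier G"
  shows "conv_pow (\<lambda>x. f x + (if x = g then a else 0)) n z
       = (\<Sum>k\<le>n. int (n choose k) * (a ^ k * conv_pow f (n - k) (inv (g [^] k) \<otimes> z)))"
  using z
proof (induction n arbitrary: z)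
  case 0
  then show ?case by simp
next
  case (Suc n)
  let ?f = "\<lambda>x. f x + (if x = g then a else 0)"
  let ?b = "\<lambda>i j. a ^ j * conv_pow f i (inv (g [^] j) \<otimes> z)"
  have split: "conv ?f h z = conv f h z + a * h (inv g \<otimes> z)" for h
  proof -
    have "conv ?f h z = (\<Sum>x\<in>carrier G. f x * h (inv x \<otimes> z) + (if x = g then a * h (inv g \<otimes> z) else 0))"
      unfolding conv_def by (intro sum.cong) (auto simp: algebra_simps)
    then show ?thesis using g by (simp add: sum.distrib conv_def)
  qed
  have step: "conv f (\<lambda>w. \<Sum>k\<le>n. int (n choose k) * (a ^ k * conv_pow f (n - k) (inv (g [^] k) \<otimes> w))) z
      = (\<Sum>k\<le>n. int (n choose k) * ?b (Suc (n - k)) k)"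
  proof -
    have "conv f (\<lambda>w. \<Sum>k\<le>n. int (n choose k) * (a ^ k * conv_pow f (n - k) (inv (g [^] k) \<otimes> w))) z
        = (\<Sum>k\<le>n. \<Sum>x\<in>carrier G. int (n choose k) * (a ^ k * (f x * conv_pow f (n - k) (inv (g [^] k) \<otimes> (inv x \<otimes> z)))))"
      unfolding conv_def by (subst sum.swap) (simp add: sum_distrib_left mult_ac)
    also have "\<dots> = (\<Sum>k\<le>n. \<Sum>x\<in>carrier G. int (n choose k) * (a ^ k * (f x * conv_pow f (n - k) (inv x \<otimes> (inv (g [^] k) \<otimes> z)))))"
      by (intro sum.cong refl) (use g Suc.prems in \<open>simp add: m_lcomm\<close>)
    also have "\<dots> = (\<Sum>k\<le>n. int (n choose k) * ?b (Suc (n - k)) k)"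
      by (simp add: conv_def sum_distrib_left)
    finally show ?thesis .
  qed
  have shift: "inv (g [^] k) \<otimes> (inv g \<otimes> z) = inv (g [^] Suc k) \<otimes> z" for k
    using g Suc.prems by (simp add: inv_mult m_assoc)
  have "conv_pow ?f (Suc n) z
      = conv f (\<lambda>w. \<Sum>k\<le>n. int (n choose k) * (a ^ k * conv_pow f (n - k) (inv (g [^] k) \<otimes> w))) z
        + a * (\<Sum>k\<le>n. int (n choose k) * (a ^ k * conv_pow f (n - k) (inv (g [^] k) \<otimes> (inv g \<otimes> z))))"
    unfolding conv_pow.simps split
    by (intro arg_cong2[where f = "(+)"] arg_cong2[where f = "(*)"] conv_cong)
       (use g Suc in auto)
  also have "\<dots> = (\<Sum>k\<le>n. int (n choose k) * (?b (Suc (n - k)) k + ?b (n - k) (Suc k)))"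
    unfolding step shift by (simp add: sum_distrib_left sum.distrib algebra_simps)
  also have "\<dots> = (\<Sum>k\<le>Suc n. int (Suc n choose k) * ?b (Suc n - k) k)"
    by (rule binomial_recursion_sum)
  finally show ?case .
qed

lemma conv_pow_cong:
  assumes "\<And>x. x \<in> carrier G \<Longrightarrow> f x = f' x" "z \<in> carrier G"
  shows "conv_pow f n z = conv_pow f' n z"
  using assms(2) by (induction n arbitrary: z) (auto intro!: conv_cong assms(1))

text \<open>Freshman's dream: the inner binomial coefficients vanish modulo \<open>q\<close>, so
  monomials can be split off one at a time.\<close>

lemma conv_pow_prime_cong:
  assumes q: "prime q" and z: "z \<in> carrier G"
  shows "int q dvd conv_pow f q z - (\<Sum>g | g \<in> carrier G \<and> g [^] q = z. f g)"
proof -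
  have q0: "q > 0" using q prime_gt_0_nat by blast
  \<comment> \<open>Induction on the support: \<open>f\<close> is cut down to a finite set
    \<open>S\<close>, which grows to the whole group.\<close>
  have *: "int q dvd conv_pow (\<lambda>x. if x \<in> S then f x else 0) q z - (\<Sum>g | g \<in> S \<and> g [^] q = z. f g)"
    if "finite S" "S \<subseteq> carrier G" for S
    using that
  proof (induction S rule: finite_induct)
    case empty
    then show ?case using q0 by (cases q) (auto simp: conv_def)
  next
    case (insert g S)
    let ?h = "\<lambda>x. if x \<in> S then f x else 0"
    let ?t = "\<lambda>k. int (q choose k) * (f g ^ k * conv_pow ?h (q - k) (inv (g [^] k) \<otimes> z))"
    have g: "g \<in> carrier G" using insert by auto
    have "(\<lambda>x. if x \<in> insert g S then f x else 0) = (\<lambda>x. ?h x + (if x = g then f g else 0))"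
      using insert by auto
    then have "conv_pow (\<lambda>x. if x \<in> insert g S then f x else 0) q z = (\<Sum>k\<le>q. ?t k)"
      using conv_pow_add_single[OF g z] by simp
    also have "{..q} = insert 0 (insert q {0<..<q})" using q0 by auto
    also have "(\<Sum>k\<in>insert 0 (insert q {0<..<q}). ?t k) = ?t 0 + ?t q + (\<Sum>k\<in>{0<..<q}. ?t k)"
      using q0 by simp
    finally have 1: "conv_pow (\<lambda>x. if x \<in> insert g S then f x else 0) q z
        = ?t 0 + ?t q + (\<Sum>k\<in>{0<..<q}. ?t k)" .
    have 2: "int q dvd (\<Sum>k\<in>{0<..<q}. ?t k)"
    proof (rule dvd_sum)
      fix k assume "k \<in> {0<..<q}"
      then have "q dvd (q choose k)" using q by (intro dvd_choose_prime) auto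
      then show "int q dvd ?t k" by (metis dvd_mult2 int_dvd_int_iff)
    qed
    have 3: "?t 0 = conv_pow ?h q z" using z by simp
    have "inv (g [^] q) \<otimes> z = \<one> \<longleftrightarrow> g [^] q = z"
      using g z by (metis inv_closed inv_equality inv_inv l_inv nat_pow_closed)
    then have 4: "?t q = (if g [^] q = z then f g ^ q else 0)" by simp
    have 5: "(\<Sum>x | x \<in> insert g S \<and> x [^] q = z. f x)
        = (if g [^] q = z then f g else 0) + (\<Sum>x | x \<in> S \<and> x [^] q = z. f x)"
    proof -
      have "{x. x \<in> insert g S \<and> x [^] q = z}
          = (if g [^] q = z then insert g {x. x \<in> S \<and> x [^] q = z} else {x. x \<in> S \<and> x [^] q = z})" by auto
      then show ?thesis using insert by auto
    qed
    have 6: "int q dvd (if g [^] q = z then f g ^ q else 0) - (if g [^] q = z then f g else 0)"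
      using prime_dvd_power_diff_self[OF q] by simp
    have "int q dvd conv_pow ?h q z - (\<Sum>g | g \<in> S \<and> g [^] q = z. f g)" using insert by auto
    from dvd_add[OF dvd_add[OF this 6] 2] show ?case
      unfolding 1 3 4 5 by (simp add: algebra_simps)
  qed
  have "conv_pow (\<lambda>x. if x \<in> carrier G then f x else 0) q z = conv_pow f q z"
    by (rule conv_pow_cong) (use z in auto)
  then show ?thesis using *[of "carrier G"] by simp
qed

text \<open>If the powers agree, the order of \<open>x \<otimes> inv y\<close> divides both
  \<open>n\<close> and the group order.\<close>

lemma pow_coprime_order_eq_iff:
  assumes "coprime n (order G)" "x \<in> carrier G" "y \<in> carrier G"
  shows "x [^] n = y [^] n \<longleftrightarrow> x = y"
proof
  assume eq: "x [^] n = y [^] n"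
  have "(x \<otimes> inv y) [^] n = \<one>"
    using eq assms by (simp add: pow_mult_distrib m_comm nat_pow_inv r_inv)
  then have "ord (x \<otimes> inv y) dvd n" using assms pow_eq_id by simp
  moreover have "ord (x \<otimes> inv y) dvd order G" using assms ord_dvd_group_order by simp
  ultimately have "ord (x \<otimes> inv y) = 1" using assms(1) by (metis coprime_common_divisor_nat)
  then have "x \<otimes> inv y = \<one>" using assms ord_eq_1 by simp
  then show "x = y" using assms by (metis inv_equality inv_inv inv_closed)
qed simp

lemma conv_pow_prime_cong_coprime:
  assumes "prime q" "coprime q (order G)" "x \<in> carrier G"
  shows "int q dvd conv_pow f q (x [^] q) - f x"
proof -
  have "{g. g \<in> carrier G \<and> g [^] q = x [^] q} = {x}"
    using assms pow_coprime_order_eq_iff by auto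
  then show ?thesis using conv_pow_prime_cong[OF assms(1), of "x [^] q" f] assms by simp
qed

text \<open>By the Frobenius congruence the group ring of \<open>G\<close> over the field with \<open>p\<close> elements is reduced
  when \<open>p\<close> does not divide the order of \<open>G\<close>.\<close>

lemma dvd_of_square_dvd_conv:
  assumes p: "prime p" "coprime p (order G)"
    and sq: "\<And>z. z \<in> carrier G \<Longrightarrow> int p ^ (2 * k) dvd conv F F z"
    and x: "x \<in> carrier G"
  shows "int p ^ k dvd F x"
  using sq x
proof (induction k arbitrary: F x)
  case 0
  then show ?case by simp
next
  case (Suc k)
  have p0: "int p \<noteq> 0" using p by auto
  have dvd: "int p dvd F x" if x: "x \<in> carrier G" for x
  proof -
    obtain n where n: "p = Suc (Suc n)" using p by (metis prime_ge_2_nat add_2_eq_Suc le_Suc_ex)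
    have pF: "int p dvd conv F F z" if "z \<in> carrier G" for z
      using Suc.prems(1)[OF that] by (simp add: dvd_mult_left)
    \<comment> \<open>Two of the \<open>p\<close> factors are grouped into the square, which is
      divisible by \<open>p\<close>; the Frobenius congruence then passes this on to
      \<open>F x\<close>.\<close>
    have "conv_pow F p (x [^] p) = conv (conv F F) (conv_pow F n) (x [^] p)"
      using x by (simp add: n conv_assoc del: nat_pow_Suc)
    then have "int p dvd conv_pow F p (x [^] p)"
      unfolding conv_def[of "conv F F"] by (auto intro!: dvd_sum dvd_mult2 pF)
    with conv_pow_prime_cong_coprime[OF p x, of F] show ?thesis
      by (metis dvd_diff_right_iff dvd_diffD1 dvd_diff_commute zdvd_zdiffD)
  qed
  \<comment> \<open>Descent: dividing \<open>F\<close> by \<open>p\<close> divides its square by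
    \<open>p\<close> twice, so the exponent \<open>2 * k\<close> is left.\<close>
  define F' where "F' = (\<lambda>x. F x div int p)"
  have F: "F x = int p * F' x" if "x \<in> carrier G" for x using dvd[OF that] by (simp add: F'_def)
  have "int p ^ k dvd F' x"
  proof (rule Suc.IH[OF _ Suc.prems(2)])
    fix z assume z: "z \<in> carrier G"
    have "conv F F z = (int p)\<^sup>2 * conv F' F' z"
      unfolding conv_def by (auto simp: sum_distrib_left F z power2_eq_square intro!: sum.cong)
    then have "(int p)\<^sup>2 * int p ^ (2 * k) dvd (int p)\<^sup>2 * conv F' F' z"
      using Suc.prems(1)[OF z] by (simp add: power_add[symmetric])
    then show "int p ^ (2 * k) dvd conv F' F' z" using p0 by simp
  qed
  then show ?case using F[OF Suc.prems(2)] by (simp add: mult_dvd_mono)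
qed

section \<open>Push-forward along a homomorphism\<close>

definition push :: "('a \<Rightarrow> 'c) \<Rightarrow> ('a \<Rightarrow> int) \<Rightarrow> 'c \<Rightarrow> int" where
  "push \<phi> f y = (\<Sum>x | x \<in> carrier G \<and> \<phi> x = y. f x)"

lemma sum_push:
  assumes "finite T" "\<phi> ` carrier G \<subseteq> T"
  shows "(\<Sum>y\<in>T. push \<phi> f y * h y) = (\<Sum>x\<in>carrier G. f x * h (\<phi> x))"
proof -
  have "(\<Sum>y\<in>T. push \<phi> f y * h y) = (\<Sum>y\<in>T. \<Sum>x | x \<in> carrier G \<and> \<phi> x = y. f x * h (\<phi> x))"
    unfolding push_def by (auto simp: sum_distrib_right intro!: sum.cong)
  also have "\<dots> = (\<Sum>x\<in>carrier G. f x * h (\<phi> x))"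
    by (rule sum.group) (use assms in auto)
  finally show ?thesis .
qed

text \<open>Push-forward is a ring homomorphism of group rings: left translation by \<open>x\<close>
  carries the fibre over \<open>inv (\<phi> x) w\<close> onto the fibre over
  \<open>w\<close>.\<close>

lemma conv_push:
  assumes "finite_comm_group H" and hom: "\<phi> \<in> hom G H" and w: "w \<in> carrier H"
  shows "finite_comm_group.conv H (push \<phi> f) (push \<phi> g) w = push \<phi> (conv f g) w"
proof -
  interpret H: finite_comm_group H by fact
  interpret group_hom G H \<phi>
    by (intro group_hom.intro group_hom_axioms.intro hom is_group H.is_group)
  have "H.conv (push \<phi> f) (push \<phi> g) w
      = (\<Sum>x\<in>carrier G. f x * push \<phi> g (inv\<^bsub>H\<^esub> \<phi> x \<otimes>\<^bsub>H\<^esub> w))"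
    unfolding H.conv_def by (rule sum_push) auto
  also have "\<dots> = (\<Sum>x\<in>carrier G. \<Sum>z | z \<in> carrier G \<and> \<phi> z = w. f x * g (inv x \<otimes> z))"
  proof (rule sum.cong)
    fix x assume x: "x \<in> carrier G"
    have "push \<phi> g (inv\<^bsub>H\<^esub> \<phi> x \<otimes>\<^bsub>H\<^esub> w) = (\<Sum>z | z \<in> carrier G \<and> \<phi> z = w. g (inv x \<otimes> z))"
      unfolding push_def
      by (rule sum.reindex_bij_witness[where i = "\<lambda>z. inv x \<otimes> z" and j = "\<lambda>z. x \<otimes> z"])
         (use x w in \<open>auto simp: m_assoc[symmetric] H.m_assoc[symmetric]\<close>)
    then show "f x * push \<phi> g (inv\<^bsub>H\<^esub> \<phi> x \<otimes>\<^bsub>H\<^esub> w)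
        = (\<Sum>z | z \<in> carrier G \<and> \<phi> z = w. f x * g (inv x \<otimes> z))"
      by (simp add: sum_distrib_left)
  qed simp
  also have "\<dots> = (\<Sum>z | z \<in> carrier G \<and> \<phi> z = w. \<Sum>x\<in>carrier G. f x * g (inv x \<otimes> z))"
    by (rule sum.swap)
  finally show ?thesis by (simp add: push_def[of \<phi> "conv f g"] conv_def)
qed

end

section \<open>Sets closed under powers prime to p\<close>

text \<open>\<open>A\<close> is partitioned into the sets \<open>cls x\<close> of generators of the
  cyclic groups spanned by its elements. Such a set has totient of \<open>p ^ j\<close> elements
  with \<open>j > 0\<close>, a multiple of \<open>p - 1\<close>.\<close>

lemma (in group) prime_minus_one_dvd_card:
  assumes p: "prime p" and fin: "finite A" and A: "A \<subseteq> carrier G"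
    and ord: "\<And>x. x \<in> A \<Longrightarrow> \<exists>j>0. ord x = p ^ j"
    and closed: "\<And>x t. x \<in> A \<Longrightarrow> coprime t p \<Longrightarrow> x [^] t \<in> A"
  shows "(p - 1) dvd card A"
proof -
  define cls where "cls x = {x [^] t |t :: nat. coprime t p}" for x
  have card_cls: "(p - 1) dvd card (cls x)" if x: "x \<in> A" for x
  proof -
    obtain j where j: "j > 0" "ord x = p ^ j" using ord[OF x] by blast
    have xG: "x \<in> carrier G" using x A by blast
    have p1: "ord x > 1" using j p one_less_power prime_gt_1_nat by metis
    have cop: "coprime t p \<longleftrightarrow> coprime t (ord x)" for t using j by simp
    have "cls x = (\<lambda>t. x [^] t) ` totatives (ord x)"
    proof (intro equalityI subsetI)
      fix y assume "y \<in> cls x"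
      then obtain t :: nat where t: "coprime t p" "y = x [^] t" by (auto simp: cls_def)
      have c: "coprime (t mod ord x) (ord x)"
        using t(1) cop p1 by (metis coprime_mod_left_iff not_one_less_zero)
      have "t mod ord x \<noteq> 0" using c p1 by (metis coprime_0_left_iff nat_dvd_1_iff_1 less_irrefl is_unit_gcd_iff)
      then have "t mod ord x \<in> totatives (ord x)"
        using c p1 by (auto simp: totatives_def intro: less_imp_le)
      moreover have "y = x [^] (t mod ord x)"
      proof -
        have "x [^] t = x [^] (ord x * (t div ord x) + t mod ord x)" by simp
        also have "\<dots> = (x [^] ord x) [^] (t div ord x) \<otimes> x [^] (t mod ord x)"
          using xG by (simp only: nat_pow_mult[symmetric] nat_pow_pow)
        finally show ?thesis using xG t by simp
      qed
      ultimately show "y \<in> (\<lambda>t. x [^] t) ` totatives (ord x)" by blast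
    next
      fix y assume "y \<in> (\<lambda>t. x [^] t) ` totatives (ord x)"
      then show "y \<in> cls x" by (auto simp: cls_def totatives_def cop)
    qed
    moreover have "inj_on (\<lambda>t. x [^] t) (totatives (ord x))"
      by (rule inj_on_subset[OF ord_inj'[OF xG]]) (auto simp: totatives_def)
    ultimately have "card (cls x) = totient (p ^ j)"
      by (simp add: card_image totient_def j)
    then show ?thesis using totient_prime_power[OF p j(1)] by simp
  qed
  have self: "x \<in> cls x" if "x \<in> A" for x
  proof -
    have "x [^] (1::nat) \<in> cls x" unfolding cls_def by (rule CollectI) (metis coprime_1_left)
    then show ?thesis using that A by auto
  qed
  have sub: "cls y \<subseteq> cls x" if yx: "y \<in> cls x" "x \<in> carrier G" for x y
  proof
    fix w assume "w \<in> cls y"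
    then obtain s :: nat where s: "coprime s p" "w = y [^] s" by (auto simp: cls_def)
    obtain t :: nat where "coprime t p" "y = x [^] t" using yx by (auto simp: cls_def)
    with s have "coprime s p" "coprime t p" "w = (x [^] t) [^] s" by auto
    then have "w = x [^] (t * s)" "coprime (t * s) p" using that by (simp_all add: nat_pow_pow)
    then show "w \<in> cls x" unfolding cls_def by blast
  qed
  \<comment> \<open>An inverse \<open>s\<close> of the exponent \<open>t\<close> modulo the order of
    \<open>x\<close> leads back from \<open>y\<close> to \<open>x\<close>.\<close>
  have sym: "x \<in> cls y" if xA: "x \<in> A" and y: "y \<in> cls x" for x y
  proof -
    obtain j where j: "j > 0" "ord x = p ^ j" using ord[OF xA] by blast
    have xG: "x \<in> carrier G" using xA A by blast
    obtain t :: nat where t: "coprime t p" "y = x [^] t" using y by (auto simp: cls_def)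
    then have "coprime t (p ^ j)" by simp
    then obtain s where s: "[t * s = 1] (mod p ^ j)" using cong_solve_coprime_nat[of t "p ^ j"] by auto
    then have "coprime (t * s) (p ^ j)" by (metis cong_imp_coprime cong_sym coprime_1_left)
    then have sp: "coprime s p" using j by simp
    have "y [^] s = x [^] (t * s)" using t xG by (simp add: nat_pow_pow)
    also have "\<dots> = x"
    proof -
      have "[int (t * s) = int 1] (mod int (ord x))" using s j by (metis cong_int_iff)
      then have "x [^] int (t * s) = x [^] int 1" using xG int_pow_eq by (metis cong_iff_dvd_diff cong_sym_eq)
      then show ?thesis using xG by (simp only: int_pow_int) simp
    qed
    finally show ?thesis using sp unfolding cls_def by force
  qed
  have "\<Union>(cls ` A) = A" using self closed by (auto simp: cls_def)
  moreover have "(p - 1) dvd card (\<Union>(cls ` A))"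
  proof (rule dvd_partition)
    show "finite (\<Union>(cls ` A))" using calculation fin by simp
    show "\<forall>c\<in>cls ` A. (p - 1) dvd card c" using card_cls by blast
    show "\<forall>c1\<in>cls ` A. \<forall>c2\<in>cls ` A. c1 \<noteq> c2 \<longrightarrow> c1 \<inter> c2 = {}"
    proof (intro ballI impI, rule ccontr)
      fix c1 c2 assume c: "c1 \<in> cls ` A" "c2 \<in> cls ` A" "c1 \<noteq> c2" "c1 \<inter> c2 \<noteq> {}"
      then obtain x y z where *: "x \<in> A" "y \<in> A" "c1 = cls x" "c2 = cls y" "z \<in> cls x" "z \<in> cls y" by blast
      have zA: "z \<in> A" using * closed by (auto simp: cls_def)
      have "cls x = cls z" "cls y = cls z"
        using * A zA sub sym by (meson subset_antisym subsetD)+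
      then show False using c * by simp
    qed
  qed
  ultimately show ?thesis by simp
qed

section \<open>Paley functions\<close>

text \<open>The function \<open>f\<close> stands for the group ring element \<open>2 D - G + e\<close>.\<close>

locale paley_function = finite_comm_group +
  fixes f :: "'a \<Rightarrow> int"
  assumes f_one: "f \<one> = 0"
    and f_sign: "\<And>x. x \<in> carrier G \<Longrightarrow> x \<noteq> \<one> \<Longrightarrow> f x = 1 \<or> f x = - 1"
    and f_inv: "\<And>x. x \<in> carrier G \<Longrightarrow> f (inv x) = f x"
    and conv_f_f: "\<And>z. z \<in> carrier G \<Longrightarrow> conv f f z = (if z = \<one> then int (order G) else 0) - 1"
begin

text \<open>By augmentation the square of this sum is \<open>v - v\<close>, with \<open>v\<close>
  the group order.\<close>

lemma sum_f: "(\<Sum>x\<in>carrier G. f x) = 0"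
proof -
  have "(\<Sum>x\<in>carrier G. f x) * (\<Sum>x\<in>carrier G. f x) = (\<Sum>z\<in>carrier G. conv f f z)"
    by (rule sum_conv[symmetric])
  also have "\<dots> = (\<Sum>z\<in>carrier G. (if z = \<one> then int (order G) else 0) - 1)"
    by (rule sum.cong) (simp_all add: conv_f_f)
  also have "\<dots> = 0" by (simp add: sum_subtractf order_def)
  finally show ?thesis by simp
qed

text \<open>Each further factor \<open>f * f = v e - G\<close> multiplies by \<open>v\<close>,
  because \<open>G * f = 0\<close> by \<open>sum_f\<close> and the symmetry of
  \<open>f\<close>.\<close>

lemma conv_pow_f:
  assumes "z \<in> carrier G"
  shows "conv_pow f (2 * j + 1) z = int (order G) ^ j * f z"
  using assms
proof (induction j arbitrary: z)
  case 0
  then show ?case using conv_pow_1 by simp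
next
  case (Suc j)
  have "conv_pow f (2 * Suc j + 1) z = conv (conv f f) (conv_pow f (2 * j + 1)) z"
    using Suc.prems by (simp add: conv_assoc)
  also have "\<dots> = conv (\<lambda>x. (if x = \<one> then int (order G) else 0) - 1) (\<lambda>x. int (order G) ^ j * f x) z"
    by (rule conv_cong) (use Suc conv_f_f in auto)
  also have "\<dots> = (\<Sum>x\<in>carrier G. (if x = \<one> then int (order G) ^ Suc j * f (inv x \<otimes> z) else 0)
      - int (order G) ^ j * f (inv x \<otimes> z))"
    unfolding conv_def by (rule sum.cong) (auto simp: algebra_simps)
  also have "\<dots> = int (order G) ^ Suc j * f z - int (order G) ^ j * (\<Sum>x\<in>carrier G. f (inv x \<otimes> z))"
    using Suc.prems by (simp add: sum_subtractf sum_distrib_left)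
  also have "(\<Sum>x\<in>carrier G. f (inv x \<otimes> z)) = (\<Sum>x\<in>carrier G. f (inv z \<otimes> x))"
  proof (rule sum.cong)
    fix x assume "x \<in> carrier G"
    then show "f (inv x \<otimes> z) = f (inv z \<otimes> x)"
      using Suc.prems f_inv[of "inv z \<otimes> x"] by (simp add: inv_mult_group)
  qed simp
  also have "\<dots> = (\<Sum>x\<in>carrier G. f x)" using Suc.prems by (simp add: sum_translate)
  finally show ?case by (simp add: sum_f)
qed

lemma f_abs_le: "x \<in> carrier G \<Longrightarrow> \<bar>f x\<bar> \<le> 1"
  using f_sign[of x] f_one by (cases "x = \<one>") auto

text \<open>Since \<open>v = m\<^sup>2\<close>, the factor \<open>v ^ j\<close> is
  \<open>m ^ (q - 1)\<close>, which is 1 modulo \<open>q\<close>. The resulting congruence is an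
  equality, as the two values differ by at most 2 and \<open>q \<ge> 3\<close>.\<close>

lemma f_pow_prime:
  assumes sq: "order G = m\<^sup>2" and q: "prime q" "odd q" "coprime q (order G)" and x: "x \<in> carrier G"
  shows "f (x [^] q) = f x"
proof -
  obtain j where j: "q = 2 * j + 1" using q(2) by (auto elim: oddE)
  have "\<not> q dvd m" using q sq
    by (metis coprime_common_divisor_nat dvd_power_same dvd_refl dvd_trans dvd_triv_left not_prime_1 power2_eq_square)
  then have "[m ^ (q - 1) = 1] (mod q)" using fermat_theorem q by blast
  then have "[order G ^ j = 1] (mod q)" using j sq by (simp add: power_mult)
  then have "[int (order G) ^ j = 1] (mod int q)" by (metis cong_int_iff of_nat_1 of_nat_power)
  then have "[int (order G) ^ j * f (x [^] q) = 1 * f (x [^] q)] (mod int q)" by (rule cong_scalar_right)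
  moreover have "[int (order G) ^ j * f (x [^] q) = f x] (mod int q)"
    using conv_pow_prime_cong_coprime[OF q(1,3) x, of f] conv_pow_f[of "x [^] q" j] x j
    by (simp add: cong_iff_dvd_diff)
  ultimately have "[f (x [^] q) = f x] (mod int q)" by (metis cong_sym cong_trans mult_1)
  then have dvd: "int q dvd f (x [^] q) - f x" by (simp add: cong_iff_dvd_diff)
  have "q \<ge> 3" using q prime_ge_2_nat[of q] by (cases "q = 2") auto
  moreover have "\<bar>f (x [^] q) - f x\<bar> \<le> 2"
    using f_abs_le[of x] f_abs_le[of "x [^] q"] x by auto
  ultimately show ?thesis using dvd zdvd_imp_le[of "int q" "\<bar>f (x [^] q) - f x\<bar>"] by fastforce
qed

text \<open>Prime factors of \<open>t\<close> are peeled off one by one; they inherit oddness and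
  coprimality.\<close>

lemma f_pow:
  assumes sq: "order G = m\<^sup>2" and t: "odd t" "coprime t (order G)" and x: "x \<in> carrier G"
  shows "f (x [^] t) = f x"
  using t x
proof (induction t arbitrary: x rule: less_induct)
  case (less t)
  show ?case
  proof (cases "t = 1")
    case True
    then show ?thesis using less.prems by simp
  next
    case False
    then obtain q where q: "prime q" "q dvd t" using prime_factor_nat by blast
    then obtain s where s: "t = q * s" by blast
    have "s > 0" "s < t" using s less.prems(1) prime_gt_1_nat[OF q(1)] by (auto intro: Nat.gr0I)
    then have "f ((x [^] q) [^] s) = f (x [^] q)"
      using less.prems s by (intro less.IH) auto
    also have "\<dots> = f x" using less.prems s q by (intro f_pow_prime[OF sq]) auto
    finally show ?thesis using s less.prems by (simp add: nat_pow_pow)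
  qed
qed

text \<open>The push-forward to \<open>G Mod P\<close> is \<open>p ^ k\<close> times an integral
  \<open>c\<close> whose squares sum to \<open>M - 1\<close>. As \<open>c\<close> is odd at the
  \<open>M - 1\<close> nontrivial cosets, each of these squares must be 1.\<close>

lemma coset_sum:
  assumes P: "subgroup P G" and card_P: "card P = p ^ (2 * k)" and ord_G: "order G = p ^ (2 * k) * M"
    and p: "prime p" "odd p" and cop: "coprime p M"
    and y: "y \<in> carrier G" "y \<notin> P"
  shows "\<bar>\<Sum>x\<in>P. f (x \<otimes> y)\<bar> = int p ^ k"
proof -
  let ?\<phi> = "\<lambda>a. P #> a" and ?H = "G Mod P"
  have normal: "P \<lhd> G" using P subgroup_imp_normal by blast
  have finH: "finite (carrier ?H)" by (simp add: carrier_FactGroup)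
  interpret H: finite_comm_group ?H
    using abelian_FactGroup[OF P] finH
    by (simp add: finite_comm_group_def finite_comm_group_axioms_def)
  have hom: "?\<phi> \<in> hom G ?H" by (rule normal.r_coset_hom_Mod[OF normal])
  interpret gh: group_hom G ?H ?\<phi>
    by (intro group_hom.intro group_hom_axioms.intro hom is_group H.is_group)
  have p0: "p > 0" using p prime_gt_0_nat by blast
  have ord_H: "order ?H = M"
  proof -
    have "order ?H * p ^ (2 * k) = p ^ (2 * k) * M"
      using lagrange[OF P] card_P ord_G by (simp add: order_def FactGroup_def)
    then show ?thesis using p0 by simp
  qed
  have Psub: "P \<subseteq> carrier G" using P subgroup.subset by blast
  have fibre: "{x. x \<in> carrier G \<and> P #> x = P #> a} = (\<lambda>x. x \<otimes> a) ` P" if a: "a \<in> carrier G" for a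
  proof -
    have "{x. x \<in> carrier G \<and> P #> x = P #> a} = P #> a"
      using a P Psub repr_independence[of _ P a] rcos_self r_coset_subset_G by blast
    then show ?thesis by (auto simp: r_coset_def)
  qed
  have inj: "inj_on (\<lambda>x. x \<otimes> a) P" if "a \<in> carrier G" for a
    using inj_on_g[OF Psub that] .
  define F where "F = push ?\<phi> f"
  have F: "F (P #> a) = (\<Sum>x\<in>P. f (x \<otimes> a))" if "a \<in> carrier G" for a
    unfolding F_def push_def fibre[OF that] using inj[OF that] by (simp add: sum.reindex)
  have triv: "P #> a = P \<longleftrightarrow> a \<in> P" if "a \<in> carrier G" for a
    using coset_join1 coset_join2 P that by blast
  have conv_F: "H.conv F F w = int p ^ (2 * k) * ((if w = P then int M else 0) - 1)"
    if w: "w \<in> carrier ?H" for w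
  proof -
    obtain a where a: "a \<in> carrier G" "w = P #> a" using w by (auto simp: carrier_FactGroup)
    have "H.conv F F w = push ?\<phi> (conv f f) w"
      unfolding F_def by (rule conv_push[OF H.finite_comm_group_axioms hom w])
    also have "\<dots> = (\<Sum>x\<in>P. conv f f (x \<otimes> a))"
      unfolding push_def a(2) fibre[OF a(1)] using inj[OF a(1)] by (simp add: sum.reindex)
    \<comment> \<open>The coset meets the identity only at \<open>x = inv a\<close>, which lies in
      \<open>P\<close> exactly when the coset is trivial.\<close>
    also have "\<dots> = (\<Sum>x\<in>P. (if x = inv a then int (order G) else 0) - 1)"
    proof (rule sum.cong)
      fix x assume "x \<in> P"
      then have x: "x \<in> carrier G" using Psub by blast
      have "x \<otimes> a = \<one> \<longleftrightarrow> x = inv a" using x a by (metis inv_equality l_inv)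
      then show "conv f f (x \<otimes> a) = (if x = inv a then int (order G) else 0) - 1"
        using x a by (simp add: conv_f_f)
    qed simp
    also have "\<dots> = (if inv a \<in> P then int (order G) else 0) - int (card P)"
      using finite_subset[OF Psub] by (simp add: sum_subtractf)
    also have "inv a \<in> P \<longleftrightarrow> w = P"
      using triv[OF a(1)] a P by (metis inv_inv subgroup.m_inv_closed)
    finally show ?thesis by (auto simp: card_P ord_G algebra_simps)
  qed
  define c where "c w = F w div int p ^ k" for w
  have dvd: "F w = int p ^ k * c w" if "w \<in> carrier ?H" for w
  proof -
    have "int p ^ k dvd F w"
      by (rule H.dvd_of_square_dvd_conv[OF p(1) _ _ that]) (use cop ord_H conv_F in auto)
    then show ?thesis by (simp add: c_def)
  qed
  have odd_c: "odd (c w)" if w: "w \<in> carrier ?H" "w \<noteq> P" for w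
  proof -
    obtain a where a: "a \<in> carrier G" "w = P #> a" using w by (auto simp: carrier_FactGroup)
    have "odd (f (x \<otimes> a))" if x: "x \<in> P" for x
    proof -
      have "x \<otimes> a \<noteq> \<one>"
      proof
        assume "x \<otimes> a = \<one>"
        then have "a = inv x" using x a Psub by (metis inv_equality inv_inv inv_closed subsetD)
        then have "a \<in> P" using subgroup.m_inv_closed[OF P x] by simp
        then show False using triv a w by simp
      qed
      moreover have "x \<otimes> a \<in> carrier G" using x a Psub by blast
      ultimately have "f (x \<otimes> a) = 1 \<or> f (x \<otimes> a) = - 1" by (rule f_sign[rotated])
      then show ?thesis by auto
    qed
    \<comment> \<open>\<open>F w\<close> is a sum of \<open>card P\<close> odd terms, and
      \<open>card P\<close> is odd; hence so is \<open>F w\<close>.\<close>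
    then have "even (\<Sum>x\<in>P. f (x \<otimes> a) - 1)" by (intro dvd_sum) simp
    then have "even (F w - int (p ^ (2 * k)))"
      by (simp add: sum_subtractf card_P a F[OF a(1)])
    then have "odd (F w)" using p by simp
    then show ?thesis using dvd[OF w(1)] by simp
  qed
  have F_inv: "F (inv\<^bsub>?H\<^esub> w) = F w" if w: "w \<in> carrier ?H" for w
    unfolding F_def push_def
    by (rule sum.reindex_bij_witness[where i = "\<lambda>x. inv x" and j = "\<lambda>x. inv x"])
       (use w f_inv in \<open>auto simp: gh.hom_inv\<close>)
  have oneH: "P \<in> carrier ?H" using H.one_closed by simp
  \<comment> \<open>\<open>P\<close> is the identity of the quotient; symmetry of \<open>F\<close>
    turns the coefficient there into the sum of squares.\<close>
  have "(\<Sum>w\<in>carrier ?H. F w * F w) = H.conv F F P"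
    unfolding H.conv_def
    by (rule sum.cong) (use F_inv H.r_one in auto)
  also have "\<dots> = int p ^ (2 * k) * (int M - 1)" using conv_F[OF oneH] by simp
  finally have "(\<Sum>w\<in>carrier ?H. (int p ^ k)\<^sup>2 * (c w)\<^sup>2) = (int p ^ k)\<^sup>2 * (int M - 1)"
    using dvd by (simp add: power2_eq_square power_mult power_mult_distrib mult_ac)
  then have sum_c: "(\<Sum>w\<in>carrier ?H. (c w)\<^sup>2) = int M - 1"
    using p0 by (simp add: sum_distrib_left[symmetric])
  have "M > 0" using H.order_gt_0_iff_finite finH ord_H by simp
  \<comment> \<open>A sum of nonnegative terms that is at most 0, so every term vanishes.\<close>
  then have "(\<Sum>w\<in>carrier ?H - {P}. (c w)\<^sup>2 - 1) = - (c P)\<^sup>2"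
    using sum_c oneH ord_H by (simp add: sum_subtractf sum_diff1 order_def)
  then have le0: "(\<Sum>w\<in>carrier ?H - {P}. (c w)\<^sup>2 - 1) \<le> 0" by simp
  have ge: "(c w)\<^sup>2 - 1 \<ge> 0" if "w \<in> carrier ?H - {P}" for w
  proof -
    have "c w \<noteq> 0" using odd_c that by force
    then have "(c w)\<^sup>2 > 0" by simp
    then show ?thesis by linarith
  qed
  have wy: "P #> y \<in> carrier ?H - {P}" using y triv by (auto simp: carrier_FactGroup)
  have "(c (P #> y))\<^sup>2 - 1 \<le> (\<Sum>w\<in>carrier ?H - {P}. (c w)\<^sup>2 - 1)"
    by (rule member_le_sum[OF wy]) (use ge finH in auto)
  then have "(c (P #> y))\<^sup>2 = 1" using le0 ge[OF wy] by linarith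
  then have "\<bar>c (P #> y)\<bar> = 1" by (auto simp: power2_eq_1_iff)
  then show ?thesis using F[OF y(1)] dvd[of "P #> y"] wy by (simp add: abs_mult)
qed

end

text \<open>Divisibility of \<open>e - d\<close> by 4 forces the signs of \<open>e\<close> and
  \<open>d\<close> to agree. The quotient of \<open>p ^ k - 1\<close> by \<open>p - 1\<close> is
  then a sum of \<open>k\<close> odd terms, so it is odd.\<close>

lemma not_dvd_prime_power_sub:
  fixes p k :: nat and e d :: int
  assumes p: "p > 1" "[p = 1] (mod 4)" and k: "odd k" and e: "\<bar>e\<bar> = int p ^ k" and d: "d = 1 \<or> d = - 1"
  shows "\<not> 2 * (int p - 1) dvd e - d"
proof
  assume dvd: "2 * (int p - 1) dvd e - d"
  have p4: "[int p = 1] (mod 4)" using p(2) by (metis cong_int_iff of_nat_1 of_nat_numeral)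
  then have p4d: "4 dvd int p - 1" by (simp add: cong_iff_dvd_diff)
  have "[int p ^ k = 1 ^ k] (mod 4)" using p4 by (rule cong_pow)
  then have pk4: "4 dvd int p ^ k - 1" by (simp add: cong_iff_dvd_diff)
  have ed4: "4 dvd e - d" using dvd p4d by (meson dvd_mult dvd_trans)
  have "e - d = int p ^ k - 1 \<or> e - d = - (int p ^ k - 1) \<or> e - d = int p ^ k + 1 \<or> e - d = - (int p ^ k + 1)"
    using e d by arith
  moreover have "\<not> 4 dvd int p ^ k + 1" using pk4 by presburger
  ultimately have "e - d = int p ^ k - 1 \<or> e - d = - (int p ^ k - 1)" using ed4 by (metis dvd_minus_iff)
  then have "2 * (int p - 1) dvd int p ^ k - 1" using dvd by (metis dvd_minus_iff)
  moreover have "int p ^ k - 1 = (int p - 1) * (\<Sum>i<k. int p ^ i)" by (rule power_diff_1_eq)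
  ultimately have "(int p - 1) * 2 dvd (int p - 1) * (\<Sum>i<k. int p ^ i)" by (simp only: mult.commute)
  then have "even (\<Sum>i<k. int p ^ i)" using p(1) by (simp only: dvd_mult_cancel_left) auto
  moreover have "odd p" using p(2) by (metis cong_def odd_iff_mod_2_eq_one cong_dvd_modulus_nat even_numeral dvd_def mult_2 numeral_Bit0 one_mod_two_eq_one)
  then have "even (\<Sum>i<k. int p ^ i - 1)" by (intro dvd_sum) simp
  ultimately show False using k by (simp add: sum_subtractf)
qed

context paley_function
begin

text \<open>Counting the values 1 gives \<open>2 * card A - (N - 1)\<close>. Here
  \<open>p - 1\<close> divides \<open>card A\<close> by closure under powers, and
  \<open>2 * (p - 1)\<close> divides \<open>N - 1\<close>.\<close>

lemma dvd_coset_sum: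
  assumes sq: "order G = m\<^sup>2" and odd_ord: "odd (order G)"
    and P: "subgroup P G" and card_P: "card P = p ^ (2 * k)" and ord_G: "order G = p ^ (2 * k) * M"
    and p: "prime p" and k: "k > 0" and cop: "coprime p M"
    and y: "y \<in> carrier G" "y \<noteq> \<one>" "y [^] M = \<one>"
  shows "2 * (int p - 1) dvd (\<Sum>x\<in>P. f (x \<otimes> y)) - f y"
proof -
  define N where "N = p ^ (2 * k)"
  have Psub: "P \<subseteq> carrier G" using P subgroup.subset by blast
  have finP: "finite P" using finite_subset[OF Psub] by simp
  have oneP: "\<one> \<in> P" using P subgroup.one_closed by blast
  have copN: "coprime N M" using cop by (simp add: N_def)
  interpret PG: group "G\<lparr>carrier := P\<rparr>" using P subgroup_imp_group by blast
  have powN: "x [^] N = \<one>" if "x \<in> P" for x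
    using PG.pow_order_eq_1[of x] that by (simp add: order_def card_P N_def nat_pow_consistent[symmetric])
  have pow_P: "x [^] t \<in> P" if "x \<in> P" for x and t :: nat
    using PG.nat_pow_closed[of x t] that by (simp add: nat_pow_consistent[symmetric])
  define A where "A = {x \<in> P - {\<one>}. f (x \<otimes> y) = 1}"
  \<comment> \<open>Otherwise the order of \<open>y\<close> would divide both \<open>N\<close> and
    \<open>M\<close>.\<close>
  have xy: "x \<otimes> y \<noteq> \<one>" if x: "x \<in> P" for x
  proof
    assume eq: "x \<otimes> y = \<one>"
    have xG: "x \<in> carrier G" using x Psub by blast
    have "y [^] N = (x \<otimes> y) [^] N" using powN[OF x] xG y by (simp add: pow_mult_distrib m_comm)
    then have "ord y dvd N" using eq y pow_eq_id by simp
    moreover have "ord y dvd M" using y pow_eq_id by simp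
    ultimately have "ord y = 1" using copN by (metis coprime_common_divisor_nat)
    then show False using y ord_eq_1 by simp
  qed
  have "(p - 1) dvd card A"
  proof (rule prime_minus_one_dvd_card[OF p])
    show "finite A" using finP by (simp add: A_def)
    show "A \<subseteq> carrier G" using Psub by (auto simp: A_def)
    fix x assume xA: "x \<in> A"
    then have x: "x \<in> P" "x \<in> carrier G" "x \<noteq> \<one>" "f (x \<otimes> y) = 1" using Psub by (auto simp: A_def)
    have "ord x dvd p ^ (2 * k)" using powN[OF x(1)] x pow_eq_id by (simp add: N_def)
    then obtain j where j: "ord x = p ^ j" using divides_primepow_nat[OF p] by blast
    moreover have "j > 0" using j x ord_eq_1[of x] by (cases j) auto
    ultimately show "\<exists>j>0. ord x = p ^ j" by blast
    fix t :: nat assume t: "coprime t p"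
    \<comment> \<open>An exponent acting as \<open>t\<close> on \<open>P\<close> and fixing
      \<open>y\<close>, so that it sends \<open>x \<otimes> y\<close> to
      \<open>x [^] t \<otimes> y\<close>.\<close>
    obtain s0 where s0: "[s0 = t] (mod N)" "[s0 = 1] (mod M)"
      using binary_chinese_remainder_nat[OF copN] by blast
    \<comment> \<open>\<open>f_pow\<close> needs an odd exponent; adding the odd group order changes
      the parity but neither residue.\<close>
    define s where "s = (if odd s0 then s0 else s0 + order G)"
    have s: "odd s" "[s = t] (mod N)" "[s = 1] (mod M)"
      using s0 odd_ord by (auto simp: s_def ord_G N_def cong_def)
    have "coprime s N" using s(2) t by (metis N_def cong_imp_coprime cong_sym coprime_power_right_iff)
    moreover have "coprime s M" using s(3) by (metis cong_imp_coprime cong_sym coprime_1_left)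
    ultimately have cs: "coprime s (order G)" by (simp add: ord_G N_def)
    have pow_cong: "g [^] a = g [^] b" if "g \<in> carrier G" "g [^] n = \<one>" "[a = b] (mod n)" for g and a b n :: nat
    proof -
      have "ord g dvd n" using that pow_eq_id by simp
      then have "[a = b] (mod ord g)" using that cong_dvd_modulus_nat by blast
      then have "int (ord g) dvd int b - int a" by (metis cong_iff_dvd_diff cong_int_iff cong_sym)
      then have "g [^] int a = g [^] int b" using that int_pow_eq by blast
      then show ?thesis by (simp only: int_pow_int)
    qed
    have "(x \<otimes> y) [^] s = x [^] s \<otimes> y [^] s" using x y by (simp add: pow_mult_distrib m_comm)
    also have "\<dots> = x [^] t \<otimes> y"
      using pow_cong[OF x(2) powN[OF x(1)] s(2)] pow_cong[OF y(1,3) s(3)] y by simp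
    finally have "f (x [^] t \<otimes> y) = 1" using f_pow[OF sq s(1) cs, of "x \<otimes> y"] x y by simp
    moreover have "x [^] t \<noteq> \<one>"
    proof
      assume "x [^] t = \<one>"
      then have "ord x dvd t" using x pow_eq_id by simp
      then have "p dvd t" using j \<open>j > 0\<close> by (metis dvd_power dvd_trans)
      then show False using t p by (metis coprime_common_divisor_nat dvd_refl not_prime_1)
    qed
    ultimately show "x [^] t \<in> A" using pow_P[OF x(1)] by (simp add: A_def)
  qed
  then have "int (p - 1) dvd int (card A)" by (simp only: int_dvd_int_iff)
  then have 1: "2 * (int p - 1) dvd 2 * int (card A)"
    using prime_gt_0_nat[OF p] by (intro mult_dvd_mono) (simp_all add: of_nat_diff)
  have "2 * (int p - 1) dvd int N - 1"
  proof -
    \<comment> \<open>The even exponent yields the factor \<open>p\<^sup>2 - 1\<close>, and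
      \<open>p + 1\<close> supplies the extra 2.\<close>
    have "int N - 1 = ((int p)\<^sup>2) ^ k - 1" by (simp add: N_def power_mult)
    also have "\<dots> = ((int p)\<^sup>2 - 1) * (\<Sum>i<k. ((int p)\<^sup>2) ^ i)" by (rule power_diff_1_eq)
    also have "(int p)\<^sup>2 - 1 = (int p + 1) * (int p - 1)" by (simp add: power2_eq_square algebra_simps)
    finally have eq: "int N - 1 = (int p + 1) * (int p - 1) * (\<Sum>i<k. ((int p)\<^sup>2) ^ i)" .
    have "odd p" using odd_ord k by (auto simp: ord_G)
    then have "2 * (int p - 1) dvd (int p + 1) * (int p - 1)" by (intro mult_dvd_mono) auto
    then show ?thesis unfolding eq by (rule dvd_mult2)
  qed
  moreover have "(\<Sum>x\<in>P. f (x \<otimes> y)) - f y = 2 * int (card A) - (int N - 1)"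
  proof -
    have "(\<Sum>x\<in>P. f (x \<otimes> y)) = f y + (\<Sum>x\<in>P - {\<one>}. f (x \<otimes> y))"
      using sum.remove[OF finP oneP, of "\<lambda>x. f (x \<otimes> y)"] y by simp
    also have "(\<Sum>x\<in>P - {\<one>}. f (x \<otimes> y)) = (\<Sum>x\<in>P - {\<one>}. 2 * (if f (x \<otimes> y) = 1 then 1 else 0) - 1)"
    proof (rule sum.cong)
      fix x assume x: "x \<in> P - {\<one>}"
      then have "x \<otimes> y \<in> carrier G" "x \<otimes> y \<noteq> \<one>" using xy y Psub by auto
      then show "f (x \<otimes> y) = 2 * (if f (x \<otimes> y) = 1 then 1 else 0) - 1" using f_sign by force
    qed simp
    also have "\<dots> = 2 * int (card A) - int (card (P - {\<one>}))"
      using finP by (simp add: sum_subtractf sum_distrib_left[symmetric] sum.If_cases A_def Int_def)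
    also have "int (card (P - {\<one>})) = int N - 1"
      using card_Suc_Diff1[OF finP oneP] by (simp add: N_def card_P[symmetric] del: of_nat_power)
    finally show ?thesis by simp
  qed
  ultimately show ?thesis using dvd_diff[OF 1] by simp
qed

text \<open>For a Sylow subgroup \<open>P\<close> and \<open>y\<close> outside it of order prime to
  \<open>p\<close>, \<open>coset_sum\<close> and \<open>dvd_coset_sum\<close> contradict
  \<open>not_dvd_prime_power_sub\<close>.\<close>

lemma not_cong_1_mod_4:
  assumes sq: "order G = m\<^sup>2" and odd_ord: "odd (order G)" and ord_G: "order G = p ^ (2 * k) * M"
    and p: "prime p" and cop: "coprime p M" and M: "M > 1" and k: "odd k"
  shows "\<not> [p = 1] (mod 4)"
proof
  assume p4: "[p = 1] (mod 4)"
  have k0: "k > 0" using k by (auto intro: Nat.gr0I)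
  obtain P where P: "subgroup P G" and card_P: "card P = p ^ (2 * k)"
    using sylow_thm[OF p is_group ord_G] by auto
  have odd_p: "odd p" using odd_ord k0 by (auto simp: ord_G)
  have Psub: "P \<subseteq> carrier G" using P subgroup.subset by blast
  have "P \<noteq> carrier G"
  proof
    assume "P = carrier G"
    then have "p ^ (2 * k) = p ^ (2 * k) * M" using card_P ord_G by (simp add: order_def)
    then show False using M prime_gt_0_nat[OF p] by simp
  qed
  then obtain g where g: "g \<in> carrier G" "g \<notin> P" using Psub by blast
  \<comment> \<open>This power removes the \<open>p\<close>-part of \<open>g\<close>. It stays
    outside \<open>P\<close>, since otherwise the order of the coset of \<open>g\<close> would
    divide both \<open>p ^ (2 * k)\<close> and \<open>M\<close>.\<close>
  define y where "y = g [^] (p ^ (2 * k))"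
  have yG: "y \<in> carrier G" using g by (simp add: y_def)
  have yM: "y [^] M = \<one>" using g pow_order_eq_1[of g] by (simp add: y_def nat_pow_pow ord_G)
  have yP: "y \<notin> P"
  proof
    assume yP: "y \<in> P"
    interpret H: comm_group "G Mod P" using abelian_FactGroup[OF P] .
    interpret gh: group_hom G "G Mod P" "\<lambda>a. P #> a"
      by (intro group_hom.intro group_hom_axioms.intro is_group H.is_group
          normal.r_coset_hom_Mod[OF subgroup_imp_normal[OF P]])
    have triv: "P #> a = P \<longleftrightarrow> a \<in> P" if "a \<in> carrier G" for a
      using coset_join1 coset_join2 P that by blast
    have c: "P #> g \<in> carrier (G Mod P)" using g by simp
    have "(P #> g) [^]\<^bsub>G Mod P\<^esub> (p ^ (2 * k)) = P"
      using triv[OF yG] yP g gh.hom_nat_pow by (simp add: y_def)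
    then have "H.ord (P #> g) dvd p ^ (2 * k)" using H.pow_eq_id[OF c] by simp
    moreover have "order (G Mod P) = M"
    proof -
      have "order (G Mod P) * p ^ (2 * k) = p ^ (2 * k) * M"
        using lagrange[OF P] card_P ord_G by (simp add: order_def FactGroup_def)
      then show ?thesis using prime_gt_0_nat[OF p] by simp
    qed
    then have "H.ord (P #> g) dvd M" using H.ord_dvd_group_order[OF c] by simp
    ultimately have "H.ord (P #> g) = 1"
      using cop by (metis coprime_common_divisor_nat coprime_power_left_iff)
    then show False using H.ord_eq_1[OF c] triv g by simp
  qed
  have y1: "y \<noteq> \<one>" using yP P subgroup.one_closed by blast
  have "\<not> 2 * (int p - 1) dvd (\<Sum>x\<in>P. f (x \<otimes> y)) - f y"
    by (rule not_dvd_prime_power_sub[OF prime_gt_1_nat[OF p] p4 k])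
       (use coset_sum[OF P card_P ord_G p odd_p cop yG yP] f_sign[OF yG y1] in auto)
  then show False
    using dvd_coset_sum[OF sq odd_ord P card_P ord_G p k0 cop yG y1 yM] by blast
qed

end

section \<open>Paley type partial difference sets\<close>

text \<open>Expand the square of \<open>2 D - G + e\<close>, using \<open>D * G = k G\<close> and
  \<open>D * D = k e + l D + m (G - D - e)\<close>; the Paley parameters collapse the
  result.\<close>

lemma paley_function_of_pds:
  fixes G (structure)
  assumes "paley_type_pds G D" "regular_subset G D"
  shows "paley_function G (\<lambda>x. if x = \<one> then 0 else if x \<in> D then 1 else - 1)"
proof -
  obtain v k l m where pds: "partial_difference_set G v k l m D"
    and params: "2 * k + 1 = v" "4 * l + 5 = v" "4 * m + 1 = v"
    using assms by (auto simp: paley_type_pds_def)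
  interpret finite_comm_group G
    using pds by (simp add: partial_difference_set_def finite_comm_group_def finite_comm_group_axioms_def)
  have D: "D \<subseteq> carrier G" "card D = k" and v: "order G = v"
    using pds by (auto simp: partial_difference_set_def)
  have inv_img: "(\<lambda>g. inv g) ` D = D" and one: "\<one> \<notin> D"
    using assms by (auto simp: regular_subset_def)
  have inv_D: "inv x \<in> D \<longleftrightarrow> x \<in> D" if "x \<in> carrier G" for x
    using inv_img that by (metis image_eqI inv_inv)
  define d where "d x = (if x \<in> D then 1 else 0 :: int)" for x
  define e where "e x = (if x = \<one> then 1 else 0 :: int)" for x
  let ?f = "\<lambda>x. if x = \<one> then 0 else if x \<in> D then 1 else - 1 :: int"
  have f: "?f x = 2 * d x - 1 + e x" for x using one by (auto simp: d_def e_def)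
  have conv_d: "conv d d z = int (if z = \<one> then k else if z \<in> D then l else m)"
    if z: "z \<in> carrier G" for z
  proof -
    have "conv d d z = (\<Sum>x\<in>carrier G. if x \<in> D \<and> inv x \<otimes> z \<in> D then 1 else 0)"
      unfolding conv_def d_def by (rule sum.cong) auto
    also have "\<dots> = int (card {x \<in> carrier G. x \<in> D \<and> inv x \<otimes> z \<in> D})"
      by (simp add: sum.If_cases Int_def)
    also have "card {x \<in> carrier G. x \<in> D \<and> inv x \<otimes> z \<in> D} = (if z = \<one> then k else if z \<in> D then l else m)"
    proof (cases "z = \<one>")
      case True
      have "{x \<in> carrier G. x \<in> D \<and> inv x \<otimes> z \<in> D} = D" using D inv_D True by auto
      then show ?thesis using True D by simp
    next
      case False
      \<comment> \<open>Because \<open>D\<close> is closed under inverses, a factorisation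
        \<open>z = x (inv x z)\<close> inside \<open>D\<close> is the same as a quotient of
        \<open>x\<close> by \<open>inv z x\<close>; the two differ as \<open>z\<close> is not the
        identity.\<close>
      have "card {x \<in> carrier G. x \<in> D \<and> inv x \<otimes> z \<in> D}
          = card {(g, h). g \<in> D \<and> h \<in> D \<and> g \<noteq> h \<and> g \<otimes> inv h = z}"
      proof (rule bij_betw_same_card, rule bij_betw_byWitness[where f = "\<lambda>x. (x, inv z \<otimes> x)" and f' = fst])
        show "(\<lambda>x. (x, inv z \<otimes> x)) ` {x \<in> carrier G. x \<in> D \<and> inv x \<otimes> z \<in> D}
            \<subseteq> {(g, h). g \<in> D \<and> h \<in> D \<and> g \<noteq> h \<and> g \<otimes> inv h = z}"
        proof clarsimp
          fix x assume x: "x \<in> carrier G" "x \<in> D" "inv x \<otimes> z \<in> D"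
          have *: "inv (inv z \<otimes> x) = inv x \<otimes> z" using x z by (simp add: inv_mult_group)
          then have "inv z \<otimes> x \<in> D" using x z inv_D[of "inv z \<otimes> x"] by simp
          moreover have "x \<otimes> inv (inv z \<otimes> x) = z" unfolding * using x z by (simp add: m_assoc[symmetric])
          moreover have "x \<noteq> inv z \<otimes> x"
          proof
            assume "x = inv z \<otimes> x"
            then show False using calculation(2) x False by (metis r_inv)
          qed
          ultimately show "inv z \<otimes> x \<in> D \<and> x \<noteq> inv z \<otimes> x \<and> x \<otimes> inv (inv z \<otimes> x) = z" by blast
        qed
        have *: "inv (g \<otimes> inv h) \<otimes> g = h" "inv g \<otimes> (g \<otimes> inv h) = inv h"
          if "g \<in> D" "h \<in> D" for g h
          using that D by (auto simp: inv_mult_group m_assoc m_assoc[symmetric] subset_iff)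
        show "fst ` {(g, h). g \<in> D \<and> h \<in> D \<and> g \<noteq> h \<and> g \<otimes> inv h = z} \<subseteq> {x \<in> carrier G. x \<in> D \<and> inv x \<otimes> z \<in> D}"
          using * D inv_D by (auto simp: subset_iff)
        show "\<forall>a'\<in>{(g, h). g \<in> D \<and> h \<in> D \<and> g \<noteq> h \<and> g \<otimes> inv h = z}. (fst a', inv z \<otimes> fst a') = a'"
          using * by auto
      qed auto
      then show ?thesis using pds z False unfolding partial_difference_set_def by auto
    qed
    finally show ?thesis .
  qed
  have sum_d: "(\<Sum>x\<in>carrier G. d x) = int k"
    using D by (simp add: d_def sum.If_cases Int_absorb1)
  have conv_f: "conv ?f ?f z = (if z = \<one> then int (order G) else 0) - 1" if z: "z \<in> carrier G" for z
  proof -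
    have sum_d': "(\<Sum>x\<in>carrier G. d (inv x \<otimes> z)) = int k"
    proof -
      have "(\<Sum>x\<in>carrier G. d (inv x \<otimes> z)) = (\<Sum>x\<in>carrier G. d (inv z \<otimes> x))"
      proof (rule sum.cong)
        fix x assume "x \<in> carrier G"
        then show "d (inv x \<otimes> z) = d (inv z \<otimes> x)"
          using z inv_D[of "inv z \<otimes> x"] by (simp add: inv_mult_group d_def)
      qed simp
      then show ?thesis using z sum_d by (simp add: sum_translate)
    qed
    have e': "e (inv x \<otimes> z) = (if x = z then 1 else 0)" if "x \<in> carrier G" for x
      using that z unfolding e_def by (metis inv_closed inv_equality inv_inv l_inv)
    \<comment> \<open>The two conditional terms come from \<open>e\<close>: the first, at
      \<open>x = z\<close>, from the right factor and including the product of both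
      \<open>e\<close>, the second from the left factor.\<close>
    have "conv ?f ?f z = (\<Sum>x\<in>carrier G. 4 * (d x * d (inv x \<otimes> z)) - 2 * d x - 2 * d (inv x \<otimes> z) + 1
        + (if x = z then 2 * d x - 1 + e x else 0) + (if x = \<one> then 2 * d (inv x \<otimes> z) - 1 else 0))"
      unfolding conv_def f
    proof (rule sum.cong)
      fix x assume x: "x \<in> carrier G"
      show "(2 * d x - 1 + e x) * (2 * d (inv x \<otimes> z) - 1 + e (inv x \<otimes> z))
        = 4 * (d x * d (inv x \<otimes> z)) - 2 * d x - 2 * d (inv x \<otimes> z) + 1
        + (if x = z then 2 * d x - 1 + e x else 0) + (if x = \<one> then 2 * d (inv x \<otimes> z) - 1 else 0)"
        unfolding e'[OF x] by (simp add: e_def algebra_simps)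
    qed simp
    also have "\<dots> = 4 * conv d d z - 2 * int k - 2 * int k + int (order G) + (2 * d z - 1 + e z) + (2 * d z - 1)"
      using z by (simp add: sum.distrib sum_subtractf sum_distrib_left[symmetric] sum_d sum_d' conv_def order_def)
    also have "\<dots> = (if z = \<one> then int (order G) else 0) - 1"
      unfolding conv_d[OF z] v using params one by (auto simp: d_def e_def)
    finally show ?thesis .
  qed
  show ?thesis
    by unfold_locales (use conv_f inv_D in \<open>auto simp: inv_eq_1_iff\<close>)
qed

theorem theorem1p2:
  fixes G :: "('a, 'b) monoid_scheme" and n :: nat and p k :: "nat \<Rightarrow> nat"
  assumes "comm_group G" and "finite (carrier G)"
    and "n \<ge> 2"
    and "\<And>i. i \<in> {1..n} \<Longrightarrow> prime (p i) \<and> odd (p i)"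
    and "inj_on p {1..n}"
    and "\<And>i. i \<in> {1..n} \<Longrightarrow> k i > 0"
    and "order G = (\<Prod>i = 1..n. p i ^ (2 * k i))"
    and "\<exists>D. paley_type_pds G D \<and> regular_subset G D"
  shows "\<forall>i \<in> {1..n}. odd (k i) \<longrightarrow> [p i = 3] (mod 4)"
proof (intro ballI impI)
  fix i assume i: "i \<in> {1..n}" and odd_k: "odd (k i)"
  obtain D where D: "paley_type_pds G D" "regular_subset G D" using assms(8) by blast
  interpret paley_function G "\<lambda>x. if x = \<one>\<^bsub>G\<^esub> then 0 else if x \<in> D then 1 else - 1"
    using paley_function_of_pds[OF D] .
  define M where "M = (\<Prod>j\<in>{1..n} - {i}. p j ^ (2 * k j))"
  have ord_M: "order G = p i ^ (2 * k i) * M"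
    unfolding assms(7) M_def using i by (intro prod.remove) auto
  have sq: "order G = (\<Prod>j = 1..n. p j ^ k j)\<^sup>2"
    unfolding assms(7) by (simp add: prod_power_distrib power_mult[symmetric] mult.commute)
  have odd_ord: "odd (order G)" unfolding assms(7) using assms(4) by (simp add: even_prod_iff)
  have cop: "coprime (p i) M"
    unfolding M_def
  proof (rule prod_coprime_right)
    fix j assume j: "j \<in> {1..n} - {i}"
    then have "p i \<noteq> p j" using assms(5) i by (auto dest: inj_onD)
    then show "coprime (p i) (p j ^ (2 * k j))" using assms(4) i j by (simp add: primes_coprime)
  qed
  \<comment> \<open>As \<open>n \<ge> 2\<close>, a second prime exists; it makes
    \<open>M > 1\<close>, so the Sylow subgroup is proper.\<close>
  obtain j where j: "j \<in> {1..n} - {i}"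
    using assms(3) i by (cases "i = 1") (auto intro: that[of 1] that[of 2])
  have "p j ^ (2 * k j) dvd M" unfolding M_def using j by (intro dvd_prodI) auto
  moreover have "p j ^ (2 * k j) > 1"
    using j assms(4,6)[of j] prime_gt_1_nat[of "p j"] by (intro one_less_power) auto
  moreover have "M \<noteq> 0" using odd_ord ord_M by (metis even_zero mult_0_right)
  ultimately have M1: "M > 1" by (meson dvd_imp_le neq0_conv order_less_le_trans)
  have "prime (p i)" "odd (p i)" using assms(4) i by auto
  moreover have "\<not> [p i = 1] (mod 4)"
    by (rule not_cong_1_mod_4[OF sq odd_ord ord_M _ cop M1 odd_k]) (use assms(4) i in auto)
  moreover have "a mod 4 = 3" if "odd a" "a mod 4 \<noteq> 1" for a :: nat using that by presburger
  ultimately show "[p i = 3] (mod 4)" by (simp add: cong_def)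
qed

end
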